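(* Let $\mathbf{u}=(u_1,u_2)$ and $\mathbf{v}=(v_1,v_2)$ be smooth maps $\mathbb{R}\to\mathbb{S}^1$ with $u_1(x)<0$, $u_2(x)>0$, $v_1(x)>0$, $v_2(x)>0$ for all $x\in\mathbb{R}$. Suppose they satisfy $$u_1'(x)\,v_1(x)\,(1-v_1(x)) - v_1'(x)\,u_1(x)\,(1+u_1(x)) \neq 0 \quad\text{for all } x\in\mathbb{R}.$$ Let $f\in C^\infty(\mathbb{R}^2_+)$ and suppose there exists a function $\tilde f\in C^\infty(\mathbb{R})\cap L^1(\mathbb{R})$ such that $f(x,y)=\tilde f(x)$ for all $(x,y)\in\mathbb{R}^2_+$. Then $f$ can be uniquely and explicitly recovered from the knowledge of its head-wave transform $\mathcal{R}f$ and the integral $\int_{-\infty}^\infty \tilde f(t)\,dt$. In fact, for all $(x,y)\in\mathbb{R}^2_+$, $$f(x,y)=\tilde f(x)=\frac{\alpha'(x)\,\partial_d\mathcal{R}f(x,d)\big|_{d=0}+\beta'(x)\,\big[\partial_x\mathcal{R}f(x,0)-\zeta(x)\big]}{\alpha'(x)\beta(x)-\beta'(x)\alpha(x)},$$ where $$\alpha(x)=\frac{1}{u_1(x)}+\frac{1}{v_1(x)},\qquad \beta(x)=1-\frac{1}{v_1(x)},\qquad \zeta(x)=\frac{u_1'(x)}{u_1(x)^2}\int_{-\infty}^\infty\tilde f(t)\,dt.$$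
   Context: Notation: $\mathbb{R}_+=\{x\in\mathbb{R}: x\ge 0\}$, $\mathbb{R}^2_+=\mathbb{R}\times\mathbb{R}_+$ (closed half-plane), $\mathbb{S}^1$ is the unit circle in $\mathbb{R}^2$. The head-wave transform of $f:\mathbb{R}^2_+\to\mathbb{R}$ (with respect to $\mathbf{u},\mathbf{v}$) is the function $\mathcal{R}f:\mathbb{R}\times\mathbb{R}_+\to\mathbb{R}$, $$\mathcal{R}f(x,d)=\int_0^\infty f\big((x,0)+t\,\mathbf{u}(x)\big)\,dt+\int_0^d f(x+t,0)\,dt+\int_0^\infty f\big((x+d,0)+t\,\mathbf{v}(x+d)\big)\,dt.$$ The derivative $\partial_d\mathcal{R}f(x,d)|_{d=0}$ is the one-sided derivative at $d=0$. *)

theory Defs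
  imports "HOL-Analysis.Analysis"
begin

definition half_plane :: "(real \<times> real) set" where
  "half_plane = UNIV \<times> {0..}"

text \<open>
  Derivatives are taken within \<open>S\<close>, hence are one-sided at the boundary of the closed half-plane.
  On the sets used here (the line and the closed half-plane) they are unique, and by recursion every
  iterated directional derivative exists and is continuous on \<open>S\<close>.
\<close>
primrec Ck_on :: "nat \<Rightarrow> 'a::real_normed_vector set \<Rightarrow> ('a \<Rightarrow> 'b::real_normed_vector) \<Rightarrow> bool" where
  "Ck_on 0 S f \<longleftrightarrow> continuous_on S f"
| "Ck_on (Suc k) S f \<longleftrightarrow>
     (\<exists>f'. (\<forall>x\<in>S. (f has_derivative f' x) (at x within S)) \<and> (\<forall>h. Ck_on k S (\<lambda>x. f' x h)))"

definition smooth_on :: "'a::real_normed_vector set \<Rightarrow> ('a \<Rightarrow> 'b::real_normed_vector) \<Rightarrow> bool" where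
  "smooth_on S f \<longleftrightarrow> (\<forall>k. Ck_on k S f)"

definition head_wave ::
  "(real \<Rightarrow> real \<times> real) \<Rightarrow> (real \<Rightarrow> real \<times> real) \<Rightarrow> (real \<times> real \<Rightarrow> real) \<Rightarrow> real \<Rightarrow> real \<Rightarrow> real" where
  "head_wave u v f x d =
     (LBINT t:{0..}. f ((x, 0) + t *\<^sub>R u x)) +
     (LBINT t:{0..d}. f (x + t, 0)) +
     (LBINT t:{0..}. f ((x + d, 0) + t *\<^sub>R v (x + d)))"

text \<open>The Lebesgue integral is total; this says that the three integrals above really exist.\<close>
definition head_wave_converges ::
  "(real \<Rightarrow> real \<times> real) \<Rightarrow> (real \<Rightarrow> real \<times> real) \<Rightarrow> (real \<times> real \<Rightarrow> real) \<Rightarrow> real \<Rightarrow> real \<Rightarrow> bool" where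
  "head_wave_converges u v f x d \<longleftrightarrow>
     set_integrable lborel {0..} (\<lambda>t. f ((x, 0) + t *\<^sub>R u x)) \<and>
     set_integrable lborel {0..d} (\<lambda>t. f (x + t, 0)) \<and>
     set_integrable lborel {0..} (\<lambda>t. f ((x + d, 0) + t *\<^sub>R v (x + d)))"

definition alpha :: "(real \<Rightarrow> real \<times> real) \<Rightarrow> (real \<Rightarrow> real \<times> real) \<Rightarrow> real \<Rightarrow> real" where
  "alpha u v x = 1 / fst (u x) + 1 / fst (v x)"

definition beta :: "(real \<Rightarrow> real \<times> real) \<Rightarrow> real \<Rightarrow> real" where
  "beta v x = 1 - 1 / fst (v x)"

text \<open>The parameter \<open>I\<close> stands for the total integral of the unknown function.\<close>
definition zeta :: "(real \<Rightarrow> real \<times> real) \<Rightarrow> real \<Rightarrow> real \<Rightarrow> real" where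
  "zeta u I x = deriv (\<lambda>s. fst (u s)) x / (fst (u x))\<^sup>2 * I"

text \<open>
  The inversion formula, depending on \<open>u\<close>, \<open>v\<close> and the data only: the transform \<open>R\<close>
  and the number \<open>I\<close>.  The derivative in \<open>d\<close> is one-sided, as \<open>R\<close> is only meaningful for \<open>d \<ge> 0\<close>.
\<close>
definition head_wave_inversion ::
  "(real \<Rightarrow> real \<times> real) \<Rightarrow> (real \<Rightarrow> real \<times> real) \<Rightarrow> (real \<Rightarrow> real \<Rightarrow> real) \<Rightarrow> real \<Rightarrow> real \<Rightarrow> real" where
  "head_wave_inversion u v R I x =
     (deriv (alpha u v) x * vector_derivative (\<lambda>d. R x d) (at 0 within {0..}) +
      deriv (beta v) x * (deriv (\<lambda>s. R s 0) x - zeta u I x)) /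
     (deriv (alpha u v) x * beta v x - deriv (beta v) x * alpha u v x)"

end

theory Submission
  imports Defs
begin

text \<open>
  Let \<open>F\<close> be the primitive of the unknown \<open>h\<close> that vanishes at \<open>-\<infinity>\<close> and \<open>I\<close> its total integral.
  Substituting in the three integrals gives
  \<open>R(x,d) = - F(x)/u\<^sub>1(x) + F(x+d) - F(x) + (I - F(x+d))/v\<^sub>1(x+d)\<close>, hence
  \<open>\<partial>\<^sub>d R(x,0) = \<beta> h - \<beta>' (I - F)\<close> and \<open>\<partial>\<^sub>x R(x,0) - \<zeta> = - \<alpha> h + \<alpha>' (I - F)\<close>.
  Eliminating the nonlocal term \<open>I - F\<close> leaves \<open>(\<alpha>' \<beta> - \<beta>' \<alpha>) h\<close>.
\<close>

section \<open>Derivatives of smooth maps and affine substitution in integrals\<close>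

lemma smooth_on_UNIV_imp_differentiable:
  fixes f :: "'a::real_normed_vector \<Rightarrow> 'b::real_normed_vector"
  assumes "smooth_on UNIV f"
  shows "f differentiable (at x)"
proof -
  have "Ck_on (Suc 0) UNIV f"
    using assms unfolding smooth_on_def by blast
  then show ?thesis
    by (auto simp: differentiable_def)
qed

lemma smooth_on_UNIV_fst_has_deriv:
  fixes w :: "real \<Rightarrow> real \<times> real"
  assumes "smooth_on UNIV w"
  shows "((\<lambda>s. fst (w s)) has_real_derivative deriv (\<lambda>s. fst (w s)) x) (at x)"
proof -
  obtain w' where "(w has_derivative w') (at x)"
    using smooth_on_UNIV_imp_differentiable[OF assms] by (auto simp: differentiable_def)
  then have "(\<lambda>s. fst (w s)) differentiable (at x)"
    by (auto simp: differentiable_def intro: has_derivative_fst)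
  then show ?thesis
    by (simp add: DERIV_deriv_iff_real_differentiable)
qed

text \<open>This is the affine change of variables on the whole line, applied to \<open>h\<close>
  cut off by the indicator of \<open>S\<close>; since \<open>T\<close> is the preimage of
  \<open>S\<close>, that indicator turns into the one of \<open>T\<close>. Slopes of both signs are
  needed, as \<open>u\<close> points left and \<open>v\<close> points right.\<close>

lemma set_integral_real_affine:
  fixes h :: "real \<Rightarrow> real"
  assumes "integrable lborel h" "c \<noteq> 0" "S \<in> sets borel" "\<And>t. x + c * t \<in> S \<longleftrightarrow> t \<in> T"
  shows "set_integrable lborel T (\<lambda>t. h (x + c * t))"
    and "(LBINT t:T. h (x + c * t)) = (LBINT t:S. h t) / \<bar>c\<bar>"
proof -
  have ind: "indicat_real S (x + c * t) = indicat_real T t" for t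
    using assms(4) by (simp add: indicator_def)
  have "set_integrable lborel S h"
    using assms(1,3) unfolding set_integrable_def
    by (intro integrable_mult_indicator) auto
  from lborel_integrable_real_affine[OF this[unfolded set_integrable_def] assms(2), of x]
  show "set_integrable lborel T (\<lambda>t. h (x + c * t))"
    by (simp add: set_integrable_def ind)
  have "(LBINT t:S. h t) = \<bar>c\<bar> * (LBINT t:T. h (x + c * t))"
    using lborel_integral_real_affine[OF assms(2), of "\<lambda>t. indicat_real S t *\<^sub>R h t" x]
    by (simp add: set_lebesgue_integral_def ind)
  then show "(LBINT t:T. h (x + c * t)) = (LBINT t:S. h t) / \<bar>c\<bar>"
    using assms(2) by simp
qed

section \<open>The primitive of an integrable function\<close>

text \<open>With base point at minus infinity, the integral over the projection of a leftward ray is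
  itself a value of the primitive.\<close>

definition primitive :: "(real \<Rightarrow> real) \<Rightarrow> real \<Rightarrow> real" where
  "primitive h x = (LBINT t:{..x}. h t)"

context
  fixes h :: "real \<Rightarrow> real"
  assumes int: "integrable lborel h"
begin

lemma set_integrable_borel: "S \<in> sets borel \<Longrightarrow> set_integrable lborel S h"
  using int unfolding set_integrable_def by (intro integrable_mult_indicator) auto

lemma primitive_diff:
  assumes "x \<le> y"
  shows "(LBINT t:{x..y}. h t) = primitive h y - primitive h x"
proof -
  have "(LBINT t:{..x} \<union> {x<..y}. h t) = (LBINT t:{..x}. h t) + (LBINT t:{x<..y}. h t)"
    by (intro set_integral_Un set_integrable_borel) auto
  moreover have "{..x} \<union> {x<..y} = {..y}"
    using assms by auto
  moreover have "(LBINT t:{x..y}. h t) = (LBINT t:{x<..y}. h t)"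
    by (rule set_integral_discrete_difference[where X = "{x}"]) auto
  ultimately show ?thesis
    by (simp add: primitive_def)
qed

lemma set_integral_atLeast: "(LBINT t:{x..}. h t) = (LBINT t. h t) - primitive h x"
proof -
  have "(LBINT t:{..x} \<union> {x<..}. h t) = (LBINT t:{..x}. h t) + (LBINT t:{x<..}. h t)"
    by (intro set_integral_Un set_integrable_borel) auto
  moreover have "{..x} \<union> {x<..} = UNIV"
    by auto
  moreover have "(LBINT t:{x..}. h t) = (LBINT t:{x<..}. h t)"
    by (rule set_integral_discrete_difference[where X = "{x}"]) auto
  ultimately show ?thesis
    by (simp add: primitive_def set_lebesgue_integral_def)
qed

text \<open>The fundamental theorem is applied on a compact interval around \<open>x\<close>, where
  the primitive and the local integral differ by the constant
  \<open>primitive h (x-1)\<close>.\<close>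

lemma primitive_has_deriv:
  assumes "continuous_on UNIV h"
  shows "(primitive h has_real_derivative h x) (at x)"
proof -
  have "continuous_on {x-1..x+1} h"
    using assms continuous_on_subset by blast
  then have "((\<lambda>y. integral {x-1..y} h) has_real_derivative h x) (at x within {x-1..x+1})"
    by (intro integral_has_real_derivative) auto
  moreover have "at x within {x-1..x+1} = at x"
    by (intro at_within_interior) auto
  ultimately have "((\<lambda>y. primitive h (x-1) + integral {x-1..y} h) has_real_derivative h x) (at x)"
    by (auto intro!: derivative_eq_intros)
  moreover have "primitive h (x-1) + integral {x-1..y} h = primitive h y" if "y \<in> {x-1<..<x+1}" for y
  proof -
    have "(LBINT t:{x-1..y}. h t) = integral {x-1..y} h"
      by (intro set_borel_integral_eq_integral set_integrable_borel) auto
    with primitive_diff[of "x-1" y] that show ?thesis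
      by simp
  qed
  ultimately show ?thesis
    by (elim has_field_derivative_transform_within_open[where S = "{x-1<..<x+1}"]) auto
qed

end

section \<open>The coefficients and the transform in closed form\<close>

locale head_wave_data =
  fixes u v :: "real \<Rightarrow> real \<times> real"
  assumes smooth_u: "smooth_on UNIV u" and smooth_v: "smooth_on UNIV v"
    and u_neg: "fst (u x) < 0" and v_pos: "fst (v x) > 0"
    and u_up: "snd (u x) > 0" and v_up: "snd (v x) > 0"
begin

lemma alpha_has_deriv:
  "(alpha u v has_real_derivative
     - deriv (\<lambda>s. fst (u s)) x / (fst (u x))\<^sup>2 - deriv (\<lambda>s. fst (v s)) x / (fst (v x))\<^sup>2) (at x)"
  using u_neg[of x] v_pos[of x] unfolding alpha_def
  by (auto intro!: derivative_eq_intros smooth_on_UNIV_fst_has_deriv[OF smooth_u]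
       smooth_on_UNIV_fst_has_deriv[OF smooth_v] simp: power2_eq_square)

lemma beta_has_deriv:
  "(beta v has_real_derivative deriv (\<lambda>s. fst (v s)) x / (fst (v x))\<^sup>2) (at x)"
  using v_pos[of x] unfolding beta_def
  by (auto intro!: derivative_eq_intros
       smooth_on_UNIV_fst_has_deriv[OF smooth_v] simp: power2_eq_square)

lemmas deriv_alpha = DERIV_imp_deriv[OF alpha_has_deriv]
lemmas deriv_beta = DERIV_imp_deriv[OF beta_has_deriv]

text \<open>The terms with \<open>fst (v x)\<close> cubed cancel. This identifies the determinant of
  the linear system for \<open>h\<close> and the nonlocal term with the nondegeneracy expression of
  the theorem, up to a nonzero factor.\<close>

lemma denominator_eq:
  "deriv (alpha u v) x * beta v x - deriv (beta v) x * alpha u v x =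
    (deriv (\<lambda>s. fst (u s)) x * fst (v x) * (1 - fst (v x))
      - deriv (\<lambda>s. fst (v s)) x * fst (u x) * (1 + fst (u x))) / ((fst (u x))\<^sup>2 * (fst (v x))\<^sup>2)"
  using u_neg[of x] v_pos[of x] unfolding deriv_alpha deriv_beta alpha_def beta_def
  by (simp add: field_simps power2_eq_square)

definition head_wave_primitive :: "(real \<Rightarrow> real) \<Rightarrow> real \<Rightarrow> real \<Rightarrow> real" where
  "head_wave_primitive h x d =
     - primitive h x / fst (u x) + (primitive h (x + d) - primitive h x) +
     ((LBINT t. h t) - primitive h (x + d)) / fst (v (x + d))"

text \<open>Along each of the three paths, \<open>f\<close> is \<open>h\<close> at an affine
  function of \<open>t\<close>, with slopes \<open>fst (u x)\<close>, \<open>1\<close> and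
  \<open>fst (v (x + d))\<close>, so three affine substitutions suffice.\<close>

lemma head_wave_horizontal:
  assumes int: "integrable lborel h" and eq: "\<forall>(x, y)\<in>half_plane. f (x, y) = h x" and "d \<ge> 0"
  shows "head_wave_converges u v f x d"
    and "head_wave u v f x d = head_wave_primitive h x d"
proof -
  \<comment> \<open>The indicator must stay in the equation: for negative \<open>t\<close> the line
    leaves the half-plane, and nothing is known of \<open>f\<close> there.\<close>
  have U: "indicat_real {0..} t *\<^sub>R f ((x, 0) + t *\<^sub>R u x)
      = indicat_real {0..} t *\<^sub>R h (x + fst (u x) * t)" for t
    using eq u_up[of x]
    by (cases "u x") (auto simp: half_plane_def indicator_def algebra_simps)
  have V: "indicat_real {0..} t *\<^sub>R f ((x + d, 0) + t *\<^sub>R v (x + d))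
      = indicat_real {0..} t *\<^sub>R h (x + d + fst (v (x + d)) * t)" for t
    using eq v_up[of "x + d"]
    by (cases "v (x + d)") (auto simp: half_plane_def indicator_def algebra_simps)
  have M: "f (x + t, 0) = h (x + 1 * t)" for t
    using eq by (auto simp: half_plane_def)
  note affine_u = set_integral_real_affine[OF int, of "fst (u x)" "{..x}" x "{0..}"]
  note affine_v = set_integral_real_affine[OF int, of "fst (v (x + d))" "{x + d..}" "x + d" "{0..}"]
  note affine_m = set_integral_real_affine[OF int, of 1 "{x..x + d}" x "{0..d}"]
  \<comment> \<open>The slope is negative, so the ray projects onto the half-line to the left of
    \<open>x\<close>.\<close>
  have cu: "x + fst (u x) * t \<in> {..x} \<longleftrightarrow> t \<in> {0..}" for t
    using u_neg[of x] by (simp add: mult_le_0_iff)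
  have cv: "x + d + fst (v (x + d)) * t \<in> {x + d..} \<longleftrightarrow> t \<in> {0..}" for t
    using v_pos[of "x + d"] by (simp add: zero_le_mult_iff)
  show "head_wave_converges u v f x d"
    using affine_u(1) affine_v(1) affine_m(1) cu cv u_neg[of x] v_pos[of "x + d"]
    unfolding head_wave_converges_def M set_integrable_def U V by simp
  show "head_wave u v f x d = head_wave_primitive h x d"
    using affine_u(2) affine_v(2) affine_m(2) cu cv u_neg[of x] v_pos[of "x + d"] \<open>d \<ge> 0\<close>
      primitive_diff[OF int, of x "x + d"] set_integral_atLeast[OF int, of "x + d"]
    unfolding head_wave_def head_wave_primitive_def M set_lebesgue_integral_def U V
    by (simp add: primitive_def set_lebesgue_integral_def)
qed

section \<open>Derivatives of the transform and inversion\<close>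

context
  fixes h :: "real \<Rightarrow> real" and R :: "real \<Rightarrow> real \<Rightarrow> real"
  assumes smooth: "smooth_on UNIV h" and int: "integrable lborel h"
    and R: "\<And>x d. d \<ge> 0 \<Longrightarrow> R x d = head_wave_primitive h x d"
begin

lemma primitive_deriv: "(primitive h has_real_derivative h x) (at x)"
  using smooth by (intro primitive_has_deriv int) (auto simp: smooth_on_def dest: spec[of _ 0])

text \<open>The closed form is differentiable on both sides of \<open>0\<close>, while
  \<open>R\<close> is prescribed only for \<open>d\<close> \<ge> 0; hence the derivative is computed
  for the closed form and then restricted. The term with \<open>deriv (beta v) x\<close> arises
  because the direction \<open>v\<close> varies with the endpoint \<open>x + d\<close>.\<close>

lemma transform_has_deriv_offset:
  "((\<lambda>d. R x d) has_real_derivative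
     beta v x * h x - deriv (beta v) x * ((LBINT t. h t) - primitive h x)) (at 0 within {0..})"
proof -
  have p: "((\<lambda>d. primitive h (x + d)) has_real_derivative h x) (at 0)"
    using primitive_deriv[of x] DERIV_shift[of "primitive h" "h x" 0 x]
    by (simp add: add.commute)
  have q: "((\<lambda>d. fst (v (x + d))) has_real_derivative deriv (\<lambda>s. fst (v s)) x) (at 0)"
    using smooth_on_UNIV_fst_has_deriv[OF smooth_v, of x]
      DERIV_shift[of "\<lambda>s. fst (v s)" "deriv (\<lambda>s. fst (v s)) x" 0 x]
    by (simp add: add.commute)
  have "((\<lambda>d. head_wave_primitive h x d) has_real_derivative
     beta v x * h x - deriv (beta v) x * ((LBINT t. h t) - primitive h x)) (at 0)"
    unfolding head_wave_primitive_def
  proof (rule DERIV_cong)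
    show "((\<lambda>d. - primitive h x / fst (u x) + (primitive h (x + d) - primitive h x) +
        ((LBINT t. h t) - primitive h (x + d)) / fst (v (x + d))) has_real_derivative
      0 + (h x - 0) + ((0 - h x) * fst (v (x + 0)) - ((LBINT t. h t) - primitive h (x + 0)) *
        deriv (\<lambda>s. fst (v s)) x) / (fst (v (x + 0)) * fst (v (x + 0)))) (at 0)"
      using v_pos[of "x + 0"]
      by (intro DERIV_add DERIV_diff DERIV_divide DERIV_const p q) simp
  qed (use v_pos[of x] in \<open>simp add: deriv_beta beta_def field_simps power2_eq_square\<close>)
  from has_field_derivative_at_within[OF this]
  show ?thesis
    by (rule has_field_derivative_transform_within[where d = 1]) (auto simp: R)
qed

text \<open>At \<open>d = 0\<close> the boundary segment contributes nothing. Writing the primitive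
  as the total integral minus the tail splits the term with the derivative of
  \<open>fst (u x)\<close> into \<open>zeta\<close> and a share of
  \<open>deriv (alpha u v) x\<close>.\<close>

lemma transform_has_deriv_position:
  "((\<lambda>s. R s 0) has_real_derivative
     zeta u (LBINT t. h t) x - alpha u v x * h x +
     deriv (alpha u v) x * ((LBINT t. h t) - primitive h x)) (at x)"
proof (rule DERIV_cong)
  let ?u' = "deriv (\<lambda>s. fst (u s)) x" and ?v' = "deriv (\<lambda>s. fst (v s)) x"
  have "((\<lambda>s. - primitive h s / fst (u s) +
        ((LBINT t. h t) - primitive h s) / fst (v s)) has_real_derivative
      (- h x * fst (u x) - - primitive h x * ?u') / (fst (u x) * fst (u x)) +
      ((0 - h x) * fst (v x) - ((LBINT t. h t) - primitive h x) * ?v') /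
        (fst (v x) * fst (v x))) (at x)"
    using v_pos[of x] u_neg[of x]
    by (intro DERIV_add DERIV_diff DERIV_divide DERIV_const DERIV_minus primitive_deriv
        smooth_on_UNIV_fst_has_deriv smooth_u smooth_v) auto
  then show "((\<lambda>s. R s 0) has_real_derivative
      (- h x * fst (u x) - - primitive h x * ?u') / (fst (u x) * fst (u x)) +
      ((0 - h x) * fst (v x) - ((LBINT t. h t) - primitive h x) * ?v') /
        (fst (v x) * fst (v x))) (at x)"
    by (simp add: R head_wave_primitive_def)
qed (use v_pos[of x] u_neg[of x] in
    \<open>simp add: deriv_alpha zeta_def alpha_def field_simps power2_eq_square\<close>)

text \<open>In the numerator the two products of \<open>deriv (alpha u v) x\<close>,
  \<open>deriv (beta v) x\<close> and the tail integral have opposite signs and cancel.\<close>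

lemma inversion_formula:
  assumes "deriv (alpha u v) x * beta v x - deriv (beta v) x * alpha u v x \<noteq> 0"
  shows "h x = head_wave_inversion u v R (LBINT t. h t) x"
proof -
  have "vector_derivative (\<lambda>d. R x d) (at 0 within {0..}) =
      beta v x * h x - deriv (beta v) x * ((LBINT t. h t) - primitive h x)"
    using transform_has_deriv_offset[of x]
    \<comment> \<open>The one-sided derivative is unique because \<open>0\<close> is a limit point
      of \<open>{0..}\<close>.\<close>
    by (intro vector_derivative_within)
       (auto simp: has_real_derivative_iff_has_vector_derivative trivial_limit_at_right_real
         at_within_Ici_at_right)
  then show ?thesis
    using assms unfolding head_wave_inversion_def DERIV_imp_deriv[OF transform_has_deriv_position]
    by (simp add: nonzero_eq_divide_eq[OF assms]) (simp add: algebra_simps)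
qed

end

end

theorem theorem1:
  fixes u v :: "real \<Rightarrow> real \<times> real"
    and f :: "real \<times> real \<Rightarrow> real"
    and ft :: "real \<Rightarrow> real"
  assumes "smooth_on UNIV u" and "\<forall>x. u x \<in> sphere 0 1"
    and "smooth_on UNIV v" and "\<forall>x. v x \<in> sphere 0 1"
    and "\<forall>x. fst (u x) < 0 \<and> snd (u x) > 0 \<and> fst (v x) > 0 \<and> snd (v x) > 0"
    and "\<forall>x. deriv (\<lambda>s. fst (u s)) x * fst (v x) * (1 - fst (v x))
             - deriv (\<lambda>s. fst (v s)) x * fst (u x) * (1 + fst (u x)) \<noteq> 0"
    and "smooth_on half_plane f"
    and "smooth_on UNIV ft" and "integrable lborel ft"
    and "\<forall>(x, y)\<in>half_plane. f (x, y) = ft x"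
  shows
    "(\<forall>x. \<forall>d\<ge>0. head_wave_converges u v f x d) \<and>
     (\<forall>x. alpha u v differentiable at x \<and> beta v differentiable at x \<and>
          (\<lambda>d. head_wave u v f x d) differentiable (at 0 within {0..}) \<and>
          (\<lambda>s. head_wave u v f s 0) differentiable (at x) \<and>
          deriv (alpha u v) x * beta v x - deriv (beta v) x * alpha u v x \<noteq> 0) \<and>
     (\<forall>(x, y)\<in>half_plane. f (x, y) = ft x \<and>
          ft x = head_wave_inversion u v (head_wave u v f) (LBINT t. ft t) x) \<and>
     (\<forall>g gt. smooth_on half_plane g \<longrightarrow> smooth_on UNIV gt \<longrightarrow> integrable lborel gt \<longrightarrow>
          (\<forall>(x, y)\<in>half_plane. g (x, y) = gt x) \<longrightarrow>
          (\<forall>x. \<forall>d\<ge>0. head_wave u v g x d = head_wave u v f x d) \<longrightarrow>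
          (LBINT t. gt t) = (LBINT t. ft t) \<longrightarrow>
          (\<forall>p\<in>half_plane. g p = f p))"
proof -
  interpret head_wave_data u v
    using assms(1,3,5) by unfold_locales auto
  let ?R = "head_wave u v f"
  have nz: "deriv (alpha u v) x * beta v x - deriv (beta v) x * alpha u v x \<noteq> 0" for x
    using assms(6) u_neg[of x] v_pos[of x] unfolding denominator_eq by simp
  have R: "?R x d = head_wave_primitive ft x d" if "d \<ge> 0" for x d
    using head_wave_horizontal(2)[OF assms(9,10) that] .
  have conv: "\<forall>x. \<forall>d\<ge>0. head_wave_converges u v f x d"
    using head_wave_horizontal(1)[OF assms(9,10)] by blast
  have diff: "\<forall>x. alpha u v differentiable at x \<and> beta v differentiable at x \<and>
      (\<lambda>d. ?R x d) differentiable (at 0 within {0..}) \<and>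
      (\<lambda>s. ?R s 0) differentiable (at x) \<and>
      deriv (alpha u v) x * beta v x - deriv (beta v) x * alpha u v x \<noteq> 0"
    using alpha_has_deriv beta_has_deriv nz transform_has_deriv_offset[OF assms(8,9) R]
      transform_has_deriv_position[OF assms(8,9) R]
    by (metis real_differentiable_def)
  have inv: "ft x = head_wave_inversion u v ?R (LBINT t. ft t) x" for x
    by (rule inversion_formula[OF assms(8,9) R nz])
  have uniq: "\<forall>p\<in>half_plane. g p = f p"
    if g: "smooth_on UNIV gt" "integrable lborel gt" "\<forall>(x, y)\<in>half_plane. g (x, y) = gt x"
      and Rg: "\<forall>x. \<forall>d\<ge>0. head_wave u v g x d = ?R x d"
      and I: "(LBINT t. gt t) = (LBINT t. ft t)" for g gt
  proof -
    \<comment> \<open>The transform of \<open>f\<close> is also the closed form for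
      \<open>gt\<close>, so the inversion formula applies to \<open>gt\<close> with the same data
      and returns the same value as for \<open>ft\<close>.\<close>
    have "?R x d = head_wave_primitive gt x d" if "d \<ge> 0" for x d
      using head_wave_horizontal(2)[OF g(2,3) that] Rg that by simp
    from inversion_formula[OF g(1,2) this nz] have "gt x = ft x" for x
      unfolding I inv[of x] .
    then show ?thesis
      using g(3) assms(10) by fastforce
  qed
  show ?thesis
  proof (intro conjI)
    show "\<forall>(x, y)\<in>half_plane. f (x, y) = ft x \<and>
        ft x = head_wave_inversion u v ?R (LBINT t. ft t) x"
      using assms(10) inv by blast
    show "\<forall>g gt. smooth_on half_plane g \<longrightarrow> smooth_on UNIV gt \<longrightarrow> integrable lborel gt \<longrightarrow>
        (\<forall>(x, y)\<in>half_plane. g (x, y) = gt x) \<longrightarrow>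
        (\<forall>x. \<forall>d\<ge>0. head_wave u v g x d = ?R x d) \<longrightarrow>
        (LBINT t. gt t) = (LBINT t. ft t) \<longrightarrow> (\<forall>p\<in>half_plane. g p = f p)"
      using uniq by blast
  qed (fact conv diff)+
qed

end
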